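(* Let $G$ be a finite, simple, connected, undirected graph. Every maximal independent set of $G$ is robust if and only if $G$ is a complete bipartite graph or a sputnik.
   Context: A connected spanning subgraph of $G=(V,E_G)$ is a connected graph $H=(V,E_H)$ with $E_H\subseteq E_G$. A maximal independent set (MIS) of $G$ is a set of pairwise non-adjacent vertices that is maximal for inclusion among such sets. An MIS $S$ of $G$ is robust if $S$ is a maximal independent set in every connected spanning subgraph of $G$ (including $G$ itself). A vertex is pendant if it has degree $1$. A graph is a sputnik if every vertex that belongs to a cycle has at least one pendant neighbor. A complete bipartite graph is a graph whose vertex set is partitioned into two disjoint sets $V_1,V_2$ such that the edge set is exactly $\{\{v_1,v_2\}: v_1\in V_1, v_2\in V_2\}$. *)

theory Defs
  imports Main
begin

definition simple_graph :: "'a set \<Rightarrow> 'a set set \<Rightarrow> bool" where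
  "simple_graph V E \<longleftrightarrow> E \<subseteq> {{u, v} | u v. u \<in> V \<and> v \<in> V \<and> u \<noteq> v}"

definition adjacent :: "'a set set \<Rightarrow> 'a \<Rightarrow> 'a \<Rightarrow> bool" where
  "adjacent E u v \<longleftrightarrow> {u, v} \<in> E"

definition walk :: "'a set \<Rightarrow> 'a set set \<Rightarrow> 'a list \<Rightarrow> bool" where
  "walk V E p \<longleftrightarrow> p \<noteq> [] \<and> set p \<subseteq> V \<and> successively (adjacent E) p"

(* The null graph counts as connected under this definition. *)
definition connected_graph :: "'a set \<Rightarrow> 'a set set \<Rightarrow> bool" where
  "connected_graph V E \<longleftrightarrow>
     (\<forall>u\<in>V. \<forall>v\<in>V. \<exists>p. walk V E p \<and> hd p = u \<and> last p = v)"

definition connected_spanning_subgraph ::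
    "'a set \<Rightarrow> 'a set set \<Rightarrow> 'a set set \<Rightarrow> bool" where
  "connected_spanning_subgraph V E F \<longleftrightarrow> F \<subseteq> E \<and> connected_graph V F"

definition independent_set :: "'a set \<Rightarrow> 'a set set \<Rightarrow> 'a set \<Rightarrow> bool" where
  "independent_set V E S \<longleftrightarrow> S \<subseteq> V \<and> (\<forall>u\<in>S. \<forall>v\<in>S. \<not> adjacent E u v)"

definition maximal_independent_set :: "'a set \<Rightarrow> 'a set set \<Rightarrow> 'a set \<Rightarrow> bool" where
  "maximal_independent_set V E S \<longleftrightarrow>
     independent_set V E S \<and> (\<forall>T. independent_set V E T \<and> S \<subseteq> T \<longrightarrow> T = S)"

definition robust_MIS :: "'a set \<Rightarrow> 'a set set \<Rightarrow> 'a set \<Rightarrow> bool" where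
  "robust_MIS V E S \<longleftrightarrow>
     maximal_independent_set V E S \<and>
     (\<forall>F. connected_spanning_subgraph V E F \<longrightarrow> maximal_independent_set V F S)"

definition degree :: "'a set set \<Rightarrow> 'a \<Rightarrow> nat" where
  "degree E v = card {e \<in> E. v \<in> e}"

definition pendant :: "'a set set \<Rightarrow> 'a \<Rightarrow> bool" where
  "pendant E v \<longleftrightarrow> degree E v = 1"

(* A cycle is listed without repeating its first vertex at the end. *)
definition cycle :: "'a set \<Rightarrow> 'a set set \<Rightarrow> 'a list \<Rightarrow> bool" where
  "cycle V E c \<longleftrightarrow>
     walk V E c \<and> distinct c \<and> length c \<ge> 3 \<and> adjacent E (last c) (hd c)"

definition sputnik :: "'a set \<Rightarrow> 'a set set \<Rightarrow> bool" where
  "sputnik V E \<longleftrightarrow>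
     (\<forall>v\<in>V. (\<exists>c. cycle V E c \<and> v \<in> set c) \<longrightarrow> (\<exists>u\<in>V. adjacent E v u \<and> pendant E u))"

definition complete_bipartite :: "'a set \<Rightarrow> 'a set set \<Rightarrow> bool" where
  "complete_bipartite V E \<longleftrightarrow>
     (\<exists>V1 V2. V1 \<union> V2 = V \<and> V1 \<inter> V2 = {} \<and>
        E = {{v1, v2} | v1 v2. v1 \<in> V1 \<and> v2 \<in> V2})"

end

theory Submission
  imports Defs
begin

text \<open>
  A maximal independent set \<open>S\<close> fails to be robust exactly when, for some \<open>v \<notin> S\<close>, deleting all edges
  between \<open>v\<close> and \<open>S\<close> keeps the graph connected.

  In a sputnik, a neighbour of \<open>v\<close> in \<open>S\<close> that is lost in a connected spanning subgraph puts \<open>v\<close> on a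
  cycle, and the pendant neighbour of \<open>v\<close> then lies in \<open>S\<close> and can never be cut off. In a complete
  bipartite graph the only maximal independent sets are the two sides.

  Conversely, let \<open>v\<close> lie on a cycle and have no pendant neighbour, and let all maximal independent sets
  be robust. If \<open>x\<close> and \<open>y\<close> are neighbours of \<open>v\<close> in the same component of \<open>G - v\<close>, they have the same
  neighbourhood: otherwise some \<open>z\<close> is adjacent to \<open>x\<close> but not to \<open>y\<close>, and a maximal independent set that
  contains \<open>y\<close>, \<open>z\<close> and, in each other component of \<open>G - v\<close>, a neighbour of a chosen neighbour
  of \<open>v\<close>, leaves every component attached to \<open>v\<close> after the deletion. Two such twins \<open>x\<close>, \<open>y\<close> exist on the
  cycle; applying the same argument at \<open>x\<close>, all neighbours of \<open>x\<close> are twins of \<open>v\<close>, so that the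
  neighbourhoods of \<open>v\<close> and \<open>x\<close> are the sides of a complete bipartite graph.
\<close>

section \<open>Adjacency, paths and pendant vertices\<close>

lemma adjacent_sym: "adjacent E u v \<longleftrightarrow> adjacent E v u"
  by (simp add: adjacent_def insert_commute)

lemma simple_graph_adjacentD:
  assumes "simple_graph V E" "adjacent E u v"
  shows "u \<in> V" "v \<in> V" "u \<noteq> v"
proof -
  have "{u, v} \<in> {{u, v} | u v. u \<in> V \<and> v \<in> V \<and> u \<noteq> v}"
    using assms by (auto simp: simple_graph_def adjacent_def)
  then show "u \<in> V" "v \<in> V" "u \<noteq> v"
    by (auto simp: doubleton_eq_iff)
qed

lemma simple_graph_edgeE:
  assumes "simple_graph V E" "e \<in> E"
  obtains u v where "e = {u, v}" "adjacent E u v"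
  using assms by (fastforce simp: simple_graph_def adjacent_def)

lemma simple_graph_subset: "simple_graph V E \<Longrightarrow> F \<subseteq> E \<Longrightarrow> simple_graph V F"
  by (auto simp: simple_graph_def)

lemma adjacent_mono: "F \<subseteq> E \<Longrightarrow> adjacent F u v \<Longrightarrow> adjacent E u v"
  by (auto simp: adjacent_def)

lemma successively_imp_rtranclp:
  "successively r p \<Longrightarrow> p \<noteq> [] \<Longrightarrow> r\<^sup>*\<^sup>* (hd p) (last p)"
proof (induction p)
  case (Cons a p)
  then show ?case
    by (cases p) (auto intro: converse_rtranclp_into_rtranclp)
qed simp

text \<open>If the new first vertex already occurs on the path, the path is cut back to that
  occurrence. Distinctness is what later allows such a path to be closed into a
  \<open>cycle\<close>.\<close>

lemma rtranclp_imp_distinct_path: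
  assumes "r\<^sup>*\<^sup>* u v"
  shows "\<exists>p. p \<noteq> [] \<and> successively r p \<and> distinct p \<and> hd p = u \<and> last p = v"
  using assms
proof (induction rule: converse_rtranclp_induct)
  case base
  then show ?case by (intro exI[of _ "[v]"]) simp
next
  case (step u w)
  then obtain p where p: "p \<noteq> []" "successively r p" "distinct p" "hd p = w" "last p = v"
    by blast
  show ?case
  proof (cases "u \<in> set p")
    case True
    then obtain as bs where "p = as @ u # bs" by (meson split_list)
    then show ?thesis
      using p by (intro exI[of _ "u # bs"]) (auto simp: successively_append_iff)
  next
    case False
    then show ?thesis
      using p step.hyps(1) by (intro exI[of _ "u # p"]) (cases p, auto)
  qed
qed

lemma successively_adjacent_subset:
  assumes "simple_graph V E" "successively (adjacent E) p" "p \<noteq> []" "hd p \<in> V"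
  shows "set p \<subseteq> V"
  using assms(2-4)
proof (induction p)
  case (Cons a p)
  then show ?case
    using simple_graph_adjacentD[OF assms(1)] by (cases p) auto
qed simp

lemma connected_graph_iff_rtranclp:
  assumes "simple_graph V E"
  shows "connected_graph V E \<longleftrightarrow> (\<forall>u\<in>V. \<forall>v\<in>V. (adjacent E)\<^sup>*\<^sup>* u v)"
proof
  assume "connected_graph V E"
  then show "\<forall>u\<in>V. \<forall>v\<in>V. (adjacent E)\<^sup>*\<^sup>* u v"
    unfolding connected_graph_def walk_def by (metis successively_imp_rtranclp)
next
  assume "\<forall>u\<in>V. \<forall>v\<in>V. (adjacent E)\<^sup>*\<^sup>* u v"
  then show "connected_graph V E"
    unfolding connected_graph_def walk_def
    by (metis rtranclp_imp_distinct_path successively_adjacent_subset[OF assms])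
qed

lemma connected_graph_has_neighbour:
  assumes "simple_graph V E" "connected_graph V E" "u \<in> V" "v \<in> V" "u \<noteq> v"
  obtains w where "adjacent E u w"
proof -
  have "(adjacent E)\<^sup>*\<^sup>* u v"
    using assms by (simp add: connected_graph_iff_rtranclp)
  then show ?thesis
    using that assms(5) by (metis converse_rtranclpE)
qed

lemma pendant_unique_neighbour:
  assumes "pendant E u" "adjacent E u v" "adjacent E u w"
  shows "v = w"
proof -
  obtain e where e: "{e \<in> E. u \<in> e} = {e}"
    using assms(1) by (auto simp: pendant_def degree_def card_1_singleton_iff)
  have "{u, v} \<in> {e \<in> E. u \<in> e}" "{u, w} \<in> {e \<in> E. u \<in> e}"
    using assms(2,3) by (auto simp: adjacent_def)
  then have "{u, v} = {u, w}"
    unfolding e by simp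
  then show ?thesis
    by (auto simp: doubleton_eq_iff)
qed

lemma pendantI:
  assumes "simple_graph V E" "adjacent E u v" "\<And>w. adjacent E u w \<Longrightarrow> w = v"
  shows "pendant E u"
proof -
  have "{e \<in> E. u \<in> e} = {{u, v}}"
  proof (intro equalityI subsetI)
    fix e assume "e \<in> {e \<in> E. u \<in> e}"
    then obtain a b where "e = {a, b}" "adjacent E a b" "u = a \<or> u = b"
      using simple_graph_edgeE[OF assms(1)]
      by (metis (no_types, lifting) insertE mem_Collect_eq singletonD)
    then show "e \<in> {{u, v}}"
      using assms(3) adjacent_sym[of E a b] by auto
  qed (use assms(2) in \<open>auto simp: adjacent_def\<close>)
  then show ?thesis
    by (simp add: pendant_def degree_def)
qed

section \<open>Maximal independent sets as dominating independent sets\<close>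

lemma maximal_independent_set_iff_dominating:
  assumes "simple_graph V E"
  shows "maximal_independent_set V E S \<longleftrightarrow>
    independent_set V E S \<and> (\<forall>v\<in>V - S. \<exists>u\<in>S. adjacent E v u)" (is "_ \<longleftrightarrow> _ \<and> ?dom")
proof
  assume max: "maximal_independent_set V E S"
  then have ind: "independent_set V E S"
    by (simp add: maximal_independent_set_def)
  have ?dom
  proof (rule ballI, rule ccontr)
    fix v assume v: "v \<in> V - S" and "\<not> (\<exists>u\<in>S. adjacent E v u)"
    then have "independent_set V E (insert v S)"
      using ind simple_graph_adjacentD(3)[OF assms, of v v]
      by (auto simp: independent_set_def adjacent_sym)
    then show False
      using max v unfolding maximal_independent_set_def by blast
  qed
  with ind show "independent_set V E S \<and> ?dom" ..
next
  assume "independent_set V E S \<and> ?dom"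
  then show "maximal_independent_set V E S"
    unfolding maximal_independent_set_def independent_set_def by blast
qed

lemma independent_set_extend_maximal:
  assumes "finite V" "independent_set V E I"
  obtains S where "maximal_independent_set V E S" "I \<subseteq> S"
proof -
  have "finite {T. independent_set V E T}"
    by (rule finite_subset[of _ "Pow V"]) (use assms(1) in \<open>auto simp: independent_set_def\<close>)
  then obtain S where "independent_set V E S" "I \<subseteq> S"
    "\<And>T. independent_set V E T \<Longrightarrow> S \<subseteq> T \<Longrightarrow> S = T"
    using finite_has_maximal2[of "{T. independent_set V E T}" I] assms(2) by auto
  then show ?thesis
    using that unfolding maximal_independent_set_def by blast
qed

text \<open>Independence survives the removal of edges, so only domination can fail in a
  subgraph.\<close>

lemma robust_MIS_iff_dominating:
  assumes "simple_graph V E" "maximal_independent_set V E S"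
  shows "robust_MIS V E S \<longleftrightarrow>
    (\<forall>F. connected_spanning_subgraph V E F \<longrightarrow> (\<forall>v\<in>V - S. \<exists>u\<in>S. adjacent F v u))"
proof -
  have "maximal_independent_set V F S \<longleftrightarrow> (\<forall>v\<in>V - S. \<exists>u\<in>S. adjacent F v u)" if "F \<subseteq> E" for F
  proof -
    have "independent_set V F S"
      using assms(2) that adjacent_mono[OF that]
      unfolding maximal_independent_set_def independent_set_def by blast
    then show ?thesis
      by (simp add: maximal_independent_set_iff_dominating[OF simple_graph_subset[OF assms(1) that]])
  qed
  then show ?thesis
    using assms(2) by (auto simp: robust_MIS_def connected_spanning_subgraph_def)
qed

section \<open>Sufficiency: sputniks and complete bipartite graphs\<close>

lemma sputnik_imp_robust_MIS:
  assumes G: "simple_graph V E" and sp: "sputnik V E" and S: "maximal_independent_set V E S"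
  shows "robust_MIS V E S"
  unfolding robust_MIS_iff_dominating[OF G S]
proof (intro allI impI ballI, rule ccontr)
  fix F v
  assume F: "connected_spanning_subgraph V E F" and v: "v \<in> V - S"
    and no: "\<not> (\<exists>u\<in>S. adjacent F v u)"
  have FE: "F \<subseteq> E" and Fc: "connected_graph V F"
    using F by (auto simp: connected_spanning_subgraph_def)
  note Fs = simple_graph_subset[OF G FE]
  have dom: "\<exists>u\<in>S. adjacent E w u" if "w \<in> V - S" for w
    using S that by (simp add: maximal_independent_set_iff_dominating[OF G])
  obtain u where u: "u \<in> S" "adjacent E v u"
    using dom v by blast
  have uv: "u \<in> V" "v \<in> V" "v \<noteq> u"
    using simple_graph_adjacentD[OF G u(2)] by auto
  have "(adjacent F)\<^sup>*\<^sup>* v u"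
    using Fc uv by (simp add: connected_graph_iff_rtranclp[OF Fs])
  then obtain p where p: "p \<noteq> []" "successively (adjacent F) p" "distinct p" "hd p = v" "last p = u"
    using rtranclp_imp_distinct_path by metis
  have "length p \<ge> 3"
  proof (rule ccontr)
    assume "\<not> length p \<ge> 3"
    then consider a where "p = [a]" | a b where "p = [a, b]"
      using p(1) by (cases p; cases "tl p"; cases "tl (tl p)") auto
    then show False
      using p uv no u(1) by cases auto
  qed
  moreover have "successively (adjacent E) p"
    using p(2) adjacent_mono[OF FE] by (rule successively_mono)
  \<comment> \<open>The path \<open>p\<close> runs in \<open>F\<close>; the edge of \<open>E\<close>
    between \<open>u\<close> and \<open>v\<close>, which is missing from \<open>F\<close>, closes
    it.\<close>
  ultimately have "cycle V E p"
    using p uv u(2) successively_adjacent_subset[OF Fs p(2,1)]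
    by (simp add: cycle_def walk_def adjacent_sym)
  moreover have "v \<in> set p"
    using p by auto
  ultimately obtain w where w: "w \<in> V" "adjacent E v w" "pendant E w"
    using sp uv unfolding sputnik_def by blast
  have only: "a = v" if "adjacent E w a" for a
    using pendant_unique_neighbour[OF w(3) that] w(2) by (simp add: adjacent_sym)
  \<comment> \<open>Outside \<open>S\<close>, the vertex \<open>w\<close> would need a neighbour in
    \<open>S\<close>, but its only neighbour is \<open>v\<close>.\<close>
  have "w \<in> S"
    using dom[of w] only v w(1) by blast
  moreover obtain a where "adjacent F w a"
    using connected_graph_has_neighbour[OF Fs Fc w(1) uv(2)] simple_graph_adjacentD(3)[OF G w(2)] by metis
  then have "adjacent F v w"
    using only adjacent_mono[OF FE] adjacent_sym by metis
  ultimately show False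
    using no by blast
qed

text \<open>Any neighbour \<open>w\<close> of \<open>v\<close> in \<open>F\<close> lies on the same
  side as the neighbour \<open>u\<close> of \<open>v\<close> in \<open>S\<close>. If
  \<open>w\<close> were not in \<open>S\<close>, it would have a neighbour in \<open>S\<close>, and
  that vertex would be adjacent to \<open>u\<close>.\<close>

lemma complete_bipartite_imp_robust_MIS:
  assumes G: "simple_graph V E" and cb: "complete_bipartite V E" and S: "maximal_independent_set V E S"
  shows "robust_MIS V E S"
  unfolding robust_MIS_iff_dominating[OF G S]
proof (intro allI impI ballI)
  fix F v
  assume F: "connected_spanning_subgraph V E F" and v: "v \<in> V - S"
  have FE: "F \<subseteq> E" and Fc: "connected_graph V F"
    using F by (auto simp: connected_spanning_subgraph_def)
  note Fs = simple_graph_subset[OF G FE]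
  obtain A B where AB: "A \<union> B = V" "A \<inter> B = {}" "E = {{a, b} | a b. a \<in> A \<and> b \<in> B}"
    using cb by (auto simp: complete_bipartite_def)
  have adj: "adjacent E a b \<longleftrightarrow> a \<in> A \<and> b \<in> B \<or> a \<in> B \<and> b \<in> A" for a b
    unfolding adjacent_def AB(3) by (auto simp: doubleton_eq_iff)
  have ind: "\<not> adjacent E a b" if "a \<in> S" "b \<in> S" for a b
    using S that by (auto simp: maximal_independent_set_def independent_set_def)
  have dom: "\<exists>u\<in>S. adjacent E w u" if "w \<in> V - S" for w
    using S that by (simp add: maximal_independent_set_iff_dominating[OF G])
  obtain u where u: "u \<in> S" "adjacent E v u"
    using dom v by blast
  obtain w where w: "adjacent F v w"
    using connected_graph_has_neighbour[OF Fs Fc] simple_graph_adjacentD[OF G u(2)] by metis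
  have "adjacent E v w"
    using adjacent_mono[OF FE w] .
  then have "w \<in> S"
    using dom[of w] ind[OF u(1)] u(2) AB(1,2) unfolding adj by blast
  then show "\<exists>u\<in>S. adjacent F v u"
    using w by blast
qed

section \<open>Necessity: twins among the neighbours of a vertex\<close>

text \<open>This is adjacency after deleting \<open>v\<close>. Between vertices other than
  \<open>v\<close>, its reflexive transitive closure means lying in the same component of the
  remaining graph.\<close>

definition avoiding :: "'a set set \<Rightarrow> 'a \<Rightarrow> 'a \<Rightarrow> 'a \<Rightarrow> bool" where
  "avoiding E v a b \<longleftrightarrow> adjacent E a b \<and> a \<noteq> v \<and> b \<noteq> v"

lemma avoiding_rtranclp_sym:
  "(avoiding E v)\<^sup>*\<^sup>* a b \<Longrightarrow> (avoiding E v)\<^sup>*\<^sup>* b a"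
  by (rule sympD[OF symp_rtranclp]) (auto intro!: sympI simp: avoiding_def adjacent_sym)

lemma cycle_imp_linked_neighbours:
  assumes "cycle V E c" "v \<in> set c"
  obtains x y where "adjacent E v x" "adjacent E v y" "x \<noteq> y" "(avoiding E v)\<^sup>*\<^sup>* x y"
proof -
  obtain ps qs where c: "c = ps @ v # qs"
    using assms(2) by (meson split_list)
  \<comment> \<open>The cycle read from just after \<open>v\<close> round to just before it: a path
    whose two ends are neighbours of \<open>v\<close>.\<close>
  define d where "d = qs @ ps"
  have suc: "successively (adjacent E) c" and "distinct c" and len: "length c \<ge> 3"
    and lh: "adjacent E (last c) (hd c)"
    using assms(1) by (auto simp: cycle_def walk_def)
  have d: "distinct d" "v \<notin> set d" "length d \<ge> 2"
    using \<open>distinct c\<close> len by (auto simp: c d_def)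
  then have ne: "d \<noteq> []" by auto
  have sucd: "successively (adjacent E) d"
    using suc lh unfolding c d_def
    by (cases "ps = []"; cases "qs = []") (auto simp: successively_append_iff successively_Cons)
  have "adjacent E v (hd d)"
    using suc lh ne unfolding c d_def
    by (cases qs; cases ps) (auto simp: successively_append_iff successively_Cons)
  moreover have "adjacent E (last d) v"
    using suc lh ne unfolding c d_def
    by (cases "ps = []"; cases "qs = []") (auto simp: successively_append_iff successively_Cons)
  then have "adjacent E v (last d)"
    by (simp add: adjacent_sym)
  moreover have "hd d \<noteq> last d"
    using d by (cases d) (auto split: if_splits)
  moreover have "successively (avoiding E v) d"
    using sucd d(2) by (auto simp: avoiding_def intro: successively_mono)
  then have "(avoiding E v)\<^sup>*\<^sup>* (hd d) (last d)"
    using ne by (rule successively_imp_rtranclp)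
  ultimately show ?thesis
    using that by blast
qed

text \<open>One inclusion between the neighbourhoods suffices, since exchanging \<open>x\<close> and
  \<open>y\<close> gives the other.\<close>

lemma linked_neighbours_twins:
  assumes fin: "finite V" and G: "simple_graph V E" and conn: "connected_graph V E"
    and rob: "\<forall>S. maximal_independent_set V E S \<longrightarrow> robust_MIS V E S"
    and np: "\<forall>u. adjacent E v u \<longrightarrow> \<not> pendant E u"
    and x: "adjacent E v x" and y: "adjacent E v y"
    and xy: "x \<noteq> y" "(avoiding E v)\<^sup>*\<^sup>* x y"
    and z: "adjacent E x z"
  shows "adjacent E y z"
proof (rule ccontr)
  assume nyz: "\<not> adjacent E y z"
  note adjD = simple_graph_adjacentD[OF G]
  let ?R = "(avoiding E v)\<^sup>*\<^sup>*"
  have Rsym: "?R a b \<Longrightarrow> ?R b a" for a b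
    by (rule avoiding_rtranclp_sym)
  have zv: "z \<noteq> v"
    using nyz y by (auto simp: adjacent_sym)
  have xz: "?R x z"
    using z zv adjD(3)[OF x] by (auto simp: avoiding_def)
  \<comment> \<open>The choice depends only on the component of \<open>u\<close>, so linked
    neighbours of \<open>v\<close> get the same representative (\<open>rep_eq\<close>).\<close>
  define rep where "rep u = (SOME w. adjacent E v w \<and> ?R u w)" for u
  have rep: "adjacent E v (rep u)" "?R u (rep u)" if "adjacent E v u" for u
    unfolding rep_def using someI[of "\<lambda>w. adjacent E v w \<and> ?R u w" u] that by auto
  have rep_eq: "rep u = rep u'" if "?R u u'" for u u'
  proof -
    have "?R u w \<longleftrightarrow> ?R u' w" for w
      using that Rsym rtranclp_trans by metis
    then show ?thesis
      by (simp add: rep_def)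
  qed
  define nb where "nb w = (SOME t. adjacent E w t \<and> t \<noteq> v)" for w
  have nb: "adjacent E w (nb w)" "nb w \<noteq> v" if "adjacent E v w" for w
  proof -
    have "\<exists>t. adjacent E w t \<and> t \<noteq> v"
      using pendantI[OF G, of w v] np that by (metis adjacent_sym)
    then show "adjacent E w (nb w)" "nb w \<noteq> v"
      unfolding nb_def by (metis (mono_tags, lifting) someI_ex)+
  qed
  have nbR: "?R u (nb (rep u))" if "adjacent E v u" for u
  proof -
    have "avoiding E v (rep u) (nb (rep u))"
      using nb[OF rep(1)[OF that]] adjD(3)[OF rep(1)[OF that]] by (auto simp: avoiding_def)
    then show ?thesis
      using rep(2)[OF that] by (rule rtranclp.rtrancl_into_rtrancl[rotated])
  qed
  define U where "U = {u. adjacent E v u \<and> \<not> ?R x u}"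
  \<comment> \<open>Each \<open>nb (rep u)\<close> keeps \<open>rep u\<close> out of
    \<open>S\<close>, just as \<open>z\<close> keeps \<open>x\<close> out; \<open>y\<close> keeps
    \<open>v\<close> out.\<close>
  define I where "I = {y, z} \<union> (\<lambda>u. nb (rep u)) ` U"
  have I_cases: "?R x a \<and> (a = y \<or> a = z) \<or> (\<exists>u\<in>U. a = nb (rep u) \<and> ?R u a)" if "a \<in> I" for a
    using that xy(2) xz nbR by (auto simp: I_def U_def)
  have I_v: "a \<noteq> v" if "a \<in> I" for a
    using that zv adjD(3)[OF y] nb(2) rep(1) by (auto simp: I_def U_def)
  have I_ind: "\<not> adjacent E a b" if I: "a \<in> I" "b \<in> I" for a b
  proof
    assume ab: "adjacent E a b"
    \<comment> \<open>Adjacent members of \<open>I\<close> share a component, and there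
      \<open>I\<close> has only \<open>y\<close> and \<open>z\<close>, or a single vertex
      \<open>nb (rep u)\<close>.\<close>
    have abR: "?R a b"
      using ab I_v I by (auto simp: avoiding_def)
    consider (1) "?R x a" "a = y \<or> a = z" "?R x b" "b = y \<or> b = z"
      | (2) u where "?R x a" "u \<in> U" "?R u b"
      | (3) u where "u \<in> U" "?R u a" "?R x b"
      | (4) u u' where "u \<in> U" "a = nb (rep u)" "?R u a" "u' \<in> U" "b = nb (rep u')" "?R u' b"
      using I_cases[OF I(1)] I_cases[OF I(2)] by metis
    then show False
    proof cases
      case 1
      then show ?thesis
        using ab nyz adjD(3)[OF ab] by (auto simp: adjacent_sym)
    next
      case 2
      then have "?R x u"
        using abR Rsym rtranclp_trans by metis
      then show ?thesis
        using 2 by (simp add: U_def)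
    next
      case 3
      then have "?R x u"
        using abR Rsym rtranclp_trans by metis
      then show ?thesis
        using 3 by (simp add: U_def)
    next
      case 4
      then have "?R u u'"
        using abR Rsym rtranclp_trans by metis
      then show ?thesis
        using 4 rep_eq adjD(3)[OF ab] by metis
    qed
  qed
  have "I \<subseteq> V"
    using adjD(2)[OF y] adjD(2)[OF z] adjD(2)[OF nb(1)] rep(1) by (auto simp: I_def U_def)
  with I_ind have "independent_set V E I"
    by (simp add: independent_set_def)
  then obtain S where S: "maximal_independent_set V E S" "I \<subseteq> S"
    using independent_set_extend_maximal[OF fin] by blast
  have S_ind: "\<not> adjacent E a b" if "a \<in> S" "b \<in> S" for a b
    using S(1) that by (auto simp: maximal_independent_set_def independent_set_def)
  have vS: "v \<notin> S" and xS: "x \<notin> S"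
    using S(2) S_ind[of v y] S_ind[of x z] y z by (auto simp: I_def)
  have repS: "rep u \<notin> S" if "u \<in> U" for u
    using S(2) S_ind[of "rep u" "nb (rep u)"] that nb(1) rep(1) by (auto simp: I_def U_def)
  define F where "F = E - {{v, s} | s. s \<in> S}"
  have FE: "F \<subseteq> E"
    by (auto simp: F_def)
  have F_adj: "adjacent F a b \<longleftrightarrow> adjacent E a b \<and> \<not> (a = v \<and> b \<in> S \<or> b = v \<and> a \<in> S)" for a b
    by (auto simp: F_def adjacent_def doubleton_eq_iff)
  have RF: "(adjacent F)\<^sup>*\<^sup>* a b" if "?R a b" for a b
    using that by (rule rtranclp_mono[THEN predicate2D, rotated]) (auto simp: avoiding_def F_adj)
  \<comment> \<open>The edges from \<open>v\<close> to \<open>x\<close> and to each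
    \<open>rep u\<close> survive, and so do all edges avoiding \<open>v\<close>.\<close>
  have reach: "(adjacent F)\<^sup>*\<^sup>* v u" if "adjacent E v u" for u
  proof (cases "?R x u")
    case True
    have "adjacent F v x"
      using x xS vS by (simp add: F_adj)
    then show ?thesis
      using RF[OF True] by (rule converse_rtranclp_into_rtranclp)
  next
    case False
    then have "u \<in> U"
      using that by (simp add: U_def)
    then have "adjacent F v (rep u)"
      using repS rep(1)[OF that] vS by (simp add: F_adj)
    then show ?thesis
      using RF[OF Rsym[OF rep(2)[OF that]]] by (rule converse_rtranclp_into_rtranclp)
  qed
  have "symp (adjacent F)"
    by (rule sympI) (simp add: adjacent_sym)
  then have Fsym: "(adjacent F)\<^sup>*\<^sup>* a b \<Longrightarrow> (adjacent F)\<^sup>*\<^sup>* b a" for a b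
    by (rule sympD[OF symp_rtranclp])
  have step: "(adjacent F)\<^sup>*\<^sup>* a b" if "adjacent E a b" for a b
  proof (cases "adjacent F a b")
    case False
    then have "a = v \<or> b = v"
      using that by (auto simp: F_adj)
    then show ?thesis
      using reach Fsym that by (auto simp: adjacent_sym)
  qed simp
  have "(adjacent F)\<^sup>*\<^sup>* a b" if "(adjacent E)\<^sup>*\<^sup>* a b" for a b
    using that by induction (auto dest: step intro: rtranclp_trans)
  then have "connected_spanning_subgraph V E F"
    using conn FE
    by (simp add: connected_spanning_subgraph_def connected_graph_iff_rtranclp[OF G]
        connected_graph_iff_rtranclp[OF simple_graph_subset[OF G FE]])
  then obtain s where "s \<in> S" "adjacent F v s"
    using rob[rule_format, OF S(1)] vS adjD(1)[OF x]
    unfolding robust_MIS_iff_dominating[OF G S(1)] by blast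
  then show False
    by (simp add: F_adj)
qed

lemma robust_MIS_imp_complete_bipartite:
  assumes fin: "finite V" and G: "simple_graph V E" and conn: "connected_graph V E"
    and rob: "\<forall>S. maximal_independent_set V E S \<longrightarrow> robust_MIS V E S"
    and ns: "\<not> sputnik V E"
  shows "complete_bipartite V E"
proof -
  note adjD = simple_graph_adjacentD[OF G]
  note twins = linked_neighbours_twins[OF fin G conn rob]
  obtain v c where v: "v \<in> V" "cycle V E c" "v \<in> set c"
    and np: "\<forall>u. adjacent E v u \<longrightarrow> \<not> pendant E u"
    using ns adjD(2) unfolding sputnik_def by metis
  obtain x y where x: "adjacent E v x" and y: "adjacent E v y" and xy: "x \<noteq> y"
    and R: "(avoiding E v)\<^sup>*\<^sup>* x y"
    using cycle_imp_linked_neighbours[OF v(2,3)] by blast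
  have twin_x: "adjacent E a t \<longleftrightarrow> adjacent E x t"
    if "adjacent E v a" "(avoiding E v)\<^sup>*\<^sup>* x a" for a t
    using twins[OF np x that(1) _ that(2)] twins[OF np that(1) x _ avoiding_rtranclp_sym[OF that(2)]]
    by metis
  have np_x: "\<forall>w. adjacent E x w \<longrightarrow> \<not> pendant E w"
  proof (intro allI impI notI)
    fix w assume w: "adjacent E x w" and "pendant E w"
    moreover have "adjacent E y w"
      using twin_x[OF y R] w by simp
    ultimately show False
      using pendant_unique_neighbour[of E w x y] w xy by (simp add: adjacent_sym)
  qed
  have twin_v: "adjacent E w t \<longleftrightarrow> adjacent E v t" if w: "adjacent E x w" for w t
  proof (cases "w = v")
    case False
    have xv: "adjacent E x v"
      using x by (simp add: adjacent_sym)
    \<comment> \<open>As a twin of \<open>x\<close>, the vertex \<open>y\<close> is adjacent to both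
      \<open>w\<close> and \<open>v\<close>, which links them without \<open>x\<close>.\<close>
    have "avoiding E x w y" "avoiding E x y v"
      using w y xv twin_x[OF y R, of w] xy adjD(3)[OF w] adjD(3)[OF x]
      by (auto simp: avoiding_def adjacent_sym)
    then have wv: "(avoiding E x)\<^sup>*\<^sup>* w v"
      by (meson converse_rtranclp_into_rtranclp r_into_rtranclp)
    show ?thesis
      using twins[OF np_x w xv False wv]
        twins[OF np_x xv w False[symmetric] avoiding_rtranclp_sym[OF wv]] by blast
  qed simp
  obtain w where w: "adjacent E x w" "w \<noteq> v"
    using pendantI[OF G, of x v] np x by (metis adjacent_sym)
  have twin_b: "adjacent E b t \<longleftrightarrow> adjacent E x t" if b: "adjacent E v b" for b t
  proof (rule twin_x[OF b])
    \<comment> \<open>The second neighbour \<open>w\<close> of \<open>x\<close> is a twin of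
      \<open>v\<close>, so it links \<open>x\<close> to every other neighbour of \<open>v\<close>.
      Hence \<open>twin_x\<close> applies to all of them.\<close>
    have "avoiding E v x w" "avoiding E v w b"
      using w adjD(3)[OF x] adjD(3)[OF b] twin_v[OF w(1), of b] b by (auto simp: avoiding_def)
    then show "(avoiding E v)\<^sup>*\<^sup>* x b"
      by (meson converse_rtranclp_into_rtranclp r_into_rtranclp)
  qed
  define A where "A = {a. adjacent E x a}"
  define B where "B = {b. adjacent E v b}"
  have vA: "v \<in> A"
    using x by (simp add: A_def adjacent_sym)
  have A: "adjacent E a t \<longleftrightarrow> t \<in> B" if "a \<in> A" for a t
    using that twin_v by (simp add: A_def B_def)
  have B: "adjacent E b t \<longleftrightarrow> t \<in> A" if "b \<in> B" for b t
    using that twin_b by (simp add: A_def B_def)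
  have "A \<inter> B = {}"
    using A B vA adjD(3) by blast
  moreover have "A \<union> B = V"
  proof
    show "A \<union> B \<subseteq> V"
      using adjD(2) by (auto simp: A_def B_def)
    show "V \<subseteq> A \<union> B"
    proof
      fix t assume "t \<in> V"
      then have "(adjacent E)\<^sup>*\<^sup>* v t"
        using conn v(1) by (simp add: connected_graph_iff_rtranclp[OF G])
      \<comment> \<open>By \<open>A\<close> and \<open>B\<close>, the set
        \<open>A \<union> B\<close> is closed under adjacency, and it contains
        \<open>v\<close>.\<close>
      then show "t \<in> A \<union> B"
        by induction (use vA A B in auto)
    qed
  qed
  moreover have "E = {{a, b} | a b. a \<in> A \<and> b \<in> B}"
  proof (intro equalityI subsetI)
    fix e assume "e \<in> E"
    then obtain a b where e: "e = {a, b}" "adjacent E a b"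
      using simple_graph_edgeE[OF G] by metis
    have "a \<in> A \<union> B"
      using \<open>A \<union> B = V\<close> adjD(1)[OF e(2)] by simp
    then have "a \<in> A \<and> b \<in> B \<or> b \<in> A \<and> a \<in> B"
      using A B e(2) by blast
    then show "e \<in> {{a, b} | a b. a \<in> A \<and> b \<in> B}"
      using e(1) by (auto simp: insert_commute)
  next
    fix e assume "e \<in> {{a, b} | a b. a \<in> A \<and> b \<in> B}"
    then show "e \<in> E"
      using A by (auto simp: adjacent_def)
  qed
  ultimately show ?thesis
    unfolding complete_bipartite_def by blast
qed

theorem theorem1:
  fixes V :: "'a set" and E :: "'a set set"
  assumes "finite V"
    and "simple_graph V E"
    and "connected_graph V E"
  shows "(\<forall>S. maximal_independent_set V E S \<longrightarrow> robust_MIS V E S) \<longleftrightarrow>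
         complete_bipartite V E \<or> sputnik V E"
  using robust_MIS_imp_complete_bipartite[OF assms] complete_bipartite_imp_robust_MIS[OF assms(2)]
    sputnik_imp_robust_MIS[OF assms(2)] by blast

end
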